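(* Let $d \in \mathbb{N}$ and let $F : \mathbb{R} \to [0,1]$ be a cumulative distribution function. For each $x \in \mathbb{R}$ and $\varepsilon \geq 0$, $$\max_{\mathbb{P} \in \mathcal{P}_d(F)} \mathbb{P}\Bigl( x < \max_{i \in [d]} X_i \leq x + \varepsilon \Bigr) = \bigl\{ d\,\bigl(F(x+\varepsilon) - F(x)\bigr) \bigr\} \land F(x+\varepsilon),$$ $$\min_{\mathbb{P} \in \mathcal{P}_d(F)} \mathbb{P}\Bigl( x < \max_{i \in [d]} X_i \leq x + \varepsilon \Bigr) = 0 \lor \bigl\{ 1 - F(x) - d\,\bigl(1 - F(x+\varepsilon)\bigr) \bigr\}.$$ In particular, both the maximum and the minimum are attained.
   Context: $\mathbb{N} = \{1,2,\ldots\}$ and $[d] = \{1,\ldots,d\}$. For real $a,b$, $a \land b$ is their minimum and $a \lor b$ their maximum. A $d$-dimensional copula is the restriction to $[0,1]^d$ of the joint cumulative distribution function (CDF) of a random vector $(U_1,\ldots,U_d)$ each of whose coordinates is uniformly distributed on $[0,1]$. For a CDF $F$ on $\mathbb{R}$, $\mathcal{P}_d(F)$ denotes the set of probability distributions $\mathbb{P}$ on $\mathbb{R}^d$ whose joint CDF has the form $\mathbb{P}(X_1 \leq x_1, \ldots, X_d \leq x_d) = C\bigl(F(x_1), \ldots, F(x_d)\bigr)$ for all $(x_1,\ldots,x_d) \in \mathbb{R}^d$, for some $d$-dimensional copula $C$; here $(X_1,\ldots,X_d)$ denotes a random vector with law $\mathbb{P}$ (so each $X_i$ has CDF $F$). 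*)

theory Defs
  imports "HOL-Probability.Probability"
begin

definition is_cdf :: "(real \<Rightarrow> real) \<Rightarrow> bool" where
  "is_cdf F \<longleftrightarrow> (\<exists>M. real_distribution M \<and> F = cdf M)"

text \<open>
  Vectors in \<open>\<real>\<^sup>d\<close> are extensional functions on the index set \<open>{1..d}\<close>, and the
  Borel sigma-algebra on \<open>\<real>\<^sup>d\<close> is the product one.  A random vector enters the notions
  below only through its law, whose coordinate projections serve as the random variables.
\<close>

definition vector_laws :: "nat \<Rightarrow> (nat \<Rightarrow> real) measure set" where
  "vector_laws d = {P. prob_space P \<and> sets P = sets (Pi\<^sub>M {1..d} (\<lambda>_. borel))}"

definition joint_cdf :: "nat \<Rightarrow> (nat \<Rightarrow> real) measure \<Rightarrow> (nat \<Rightarrow> real) \<Rightarrow> real" where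
  "joint_cdf d P x = measure P {X \<in> space P. \<forall>i\<in>{1..d}. X i \<le> x i}"

definition is_copula :: "nat \<Rightarrow> ((nat \<Rightarrow> real) \<Rightarrow> real) \<Rightarrow> bool" where
  "is_copula d C \<longleftrightarrow>
     (\<exists>Q\<in>vector_laws d.
        (\<forall>i\<in>{1..d}. distr Q borel (\<lambda>U. U i) = uniform_measure lborel {0..1}) \<and>
        C = restrict (joint_cdf d Q) ({1..d} \<rightarrow>\<^sub>E {0..1}))"

definition laws_with_marginal :: "nat \<Rightarrow> (real \<Rightarrow> real) \<Rightarrow> (nat \<Rightarrow> real) measure set" where
  "laws_with_marginal d F =
     {P \<in> vector_laws d. \<exists>C. is_copula d C \<and>
        (\<forall>x \<in> {1..d} \<rightarrow>\<^sub>E UNIV. joint_cdf d P x = C (\<lambda>i\<in>{1..d}. F (x i)))}"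

definition prob_max_in :: "nat \<Rightarrow> real \<Rightarrow> real \<Rightarrow> (nat \<Rightarrow> real) measure \<Rightarrow> real" where
  "prob_max_in d a b P =
     measure P {X \<in> space P. a < Max (X ` {1..d}) \<and> Max (X ` {1..d}) \<le> b}"

definition is_maximum :: "real set \<Rightarrow> real \<Rightarrow> bool" where
  "is_maximum S m \<longleftrightarrow> m \<in> S \<and> (\<forall>s\<in>S. s \<le> m)"

definition is_minimum :: "real set \<Rightarrow> real \<Rightarrow> bool" where
  "is_minimum S m \<longleftrightarrow> m \<in> S \<and> (\<forall>s\<in>S. m \<le> s)"

end

theory Submission
  imports Defs
begin

text \<open>
  Write \<open>a = F x\<close> and \<open>b = F (x + \<epsilon>)\<close>.  The event in question is the difference of the boxes
  \<open>{\<forall>i. X i \<le> x + \<epsilon>}\<close> and \<open>{\<forall>i. X i \<le> x}\<close>, so its probability is \<open>C (b, \<dots>, b) - C (a, \<dots>, a)\<close>,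
  which is the probability of \<open>a < max U i \<le> b\<close> under the law of the copula \<open>C\<close>.  Conversely, the
  quantile function of \<open>F\<close>, applied to each coordinate, turns every law with uniform marginals into
  a law with marginal \<open>F\<close> and the same copula.  Both extremal problems therefore reduce to uniform
  marginals (\<open>prob_max_in_image_copula\<close>).

  For uniform marginals the two inequalities are union bounds (\<open>prob_max_in_copula_bounds\<close>): the
  event is contained in \<open>{U 1 \<le> b}\<close> and in the union of the \<open>{a < U i \<le> b}\<close>, and together with the
  \<open>{U i > b}\<close> it covers \<open>{U 1 > a}\<close>.

  Equality is attained by rotations.  Let \<open>V\<close> be uniform on \<open>[0, 1]\<close> and let \<open>U i\<close> arise from \<open>V\<close>
  by rotating an interval \<open>(l, r]\<close>, viewed as a circle of length \<open>r - l\<close>, by \<open>(i - 1) s\<close>, and fixing all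
  points outside it; each \<open>U i\<close> is again uniform.  As \<open>i\<close> increases, a point starting in \<open>(l, r]\<close>
  advances in steps of length \<open>s\<close>, and it lies in the last stretch \<open>(r - s, r]\<close> exactly when its next step
  passes \<open>r\<close>.  So it visits that stretch for some \<open>i \<le> d\<close> if and only if \<open>V + d s > r\<close>
  (\<open>rotate_on_exists_gt_iff\<close>), an event of probability \<open>min (d s) (r - l)\<close> within \<open>(l, r]\<close>.  The choice
  \<open>l = 0\<close>, \<open>r = b\<close>, \<open>s = b - a\<close> gives the maximum.  The choice \<open>l = a\<close>, \<open>r = 1\<close>, \<open>s = 1 - b\<close> gives
  the minimum, the event then being that the orbit of a point of \<open>(a, 1]\<close> avoids \<open>(b, 1]\<close>.
\<close>

section \<open>Reduction to uniform marginals\<close>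

text \<open>The laws on \<open>\<real>\<^sup>d\<close> whose coordinates are uniform on \<open>[0, 1]\<close>.\<close>

definition copula_laws :: "nat \<Rightarrow> (nat \<Rightarrow> real) measure set" where
  "copula_laws d =
     {Q \<in> vector_laws d. \<forall>i\<in>{1..d}. distr Q borel (\<lambda>U. U i) = uniform_measure lborel {0..1}}"

lemma is_copula_iff:
  "is_copula d C \<longleftrightarrow> (\<exists>Q\<in>copula_laws d. C = restrict (joint_cdf d Q) ({1..d} \<rightarrow>\<^sub>E {0..1}))"
  by (auto simp: is_copula_def copula_laws_def)

lemma measurable_vector_component [measurable (raw)]:
  assumes "P \<in> vector_laws d" "i \<in> {1..d}"
  shows "(\<lambda>X. X i) \<in> borel_measurable P"
proof -
  have "sets P = sets (Pi\<^sub>M {1..d} (\<lambda>_. borel))"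
    using assms(1) by (simp add: vector_laws_def)
  then show ?thesis
    using measurable_component_singleton[OF assms(2), of "\<lambda>_. borel :: real measure"]
      measurable_cong_sets by blast
qed

lemma sets_all_le:
  assumes "P \<in> vector_laws d"
  shows "{X \<in> space P. \<forall>i\<in>{1..d}. X i \<le> (x i :: real)} \<in> sets P"
  by (rule sets.sets_Collect_finite_All)
     (auto intro!: borel_measurable_le borel_measurable_const measurable_vector_component[OF assms])

lemma prob_max_in_eq_event:
  assumes "d \<ge> 1"
  shows "prob_max_in d a b P =
     measure P {X \<in> space P. (\<exists>i\<in>{1..d}. a < X i) \<and> (\<forall>i\<in>{1..d}. X i \<le> b)}"
proof -
  have "{1..d} \<noteq> {}"
    using assms by simp
  then show ?thesis
    unfolding prob_max_in_def
    by (intro arg_cong[where f = "measure P"]) (auto simp: Max_gr_iff)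
qed

lemma prob_max_in_eq_joint_cdf_diff:
  assumes "d \<ge> 1" and P: "P \<in> vector_laws d" and "x \<le> y"
  shows "prob_max_in d x y P = joint_cdf d P (\<lambda>_. y) - joint_cdf d P (\<lambda>_. x)"
proof -
  interpret prob_space P
    using P by (simp add: vector_laws_def)
  let ?B = "\<lambda>t. {X \<in> space P. \<forall>i\<in>{1..d}. X i \<le> t}"
  have "{X \<in> space P. (\<exists>i\<in>{1..d}. x < X i) \<and> (\<forall>i\<in>{1..d}. X i \<le> y)} = ?B y - ?B x"
    by (auto simp: not_le)
  moreover have "?B x \<subseteq> ?B y"
    using \<open>x \<le> y\<close> by fastforce
  ultimately show ?thesis
    unfolding prob_max_in_eq_event[OF assms(1)] joint_cdf_def
    using finite_measure_Diff[OF sets_all_le[OF P] sets_all_le[OF P]] by simp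
qed

lemma joint_cdf_cong:
  assumes "\<And>i. i \<in> {1..d} \<Longrightarrow> x i = y i"
  shows "joint_cdf d P x = joint_cdf d P y"
  using assms by (simp add: joint_cdf_def cong: conj_cong)

lemma is_cdf_bounds:
  assumes "is_cdf F"
  shows "mono F" "0 \<le> F x" "F x \<le> 1"
proof -
  obtain M where M: "real_distribution M" "F = cdf M"
    using assms by (auto simp: is_cdf_def)
  interpret real_distribution M by fact
  show "mono F" "0 \<le> F x" "F x \<le> 1"
    using cdf_nondecreasing cdf_nonneg cdf_bounded_prob M(2) by (auto intro!: monoI)
qed

text \<open>
  Outside \<open>(0, 1)\<close> the generalised inverse is an infimum of a set that may be empty or unbounded
  below.  There \<open>q\<close> is set to \<open>0\<close>, which makes it Borel on the whole line.
\<close>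

lemma is_cdf_quantile:
  assumes "is_cdf F"
  obtains q :: "real \<Rightarrow> real" where "q \<in> borel_measurable borel"
    and "\<And>u x. 0 < u \<Longrightarrow> u < 1 \<Longrightarrow> q u \<le> x \<longleftrightarrow> u \<le> F x"
proof -
  obtain M where M: "real_distribution M" "F = cdf M"
    using assms by (auto simp: is_cdf_def)
  interpret cdf_distribution M
    unfolding cdf_distribution_def by fact
  let ?q = "\<lambda>u. if u \<in> {0<..<1} then I u else 0"
  have "?q \<in> borel_measurable borel"
    using measurable_CI by (subst (asm) measurable_restrict_space_iff[where c = 0]) auto
  then show thesis
  proof (rule that)
    show "?q u \<le> x \<longleftrightarrow> u \<le> F x" if "0 < u" "u < 1" for u x
      using pseudoinverse[OF that, of x] that M(2) by simp
  qed
qed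

lemma AE_copula_law_interior:
  assumes Q: "Q \<in> copula_laws d"
  shows "AE U in Q. \<forall>i\<in>{1..d}. 0 < U i \<and> U i < 1"
proof -
  have V: "Q \<in> vector_laws d"
    using Q by (simp add: copula_laws_def)
  have "AE U in Q. 0 < U i \<and> U i < 1" if i: "i \<in> {1..d}" for i
  proof -
    have boundary: "AE u in (lborel :: real measure). u \<noteq> 0 \<and> u \<noteq> 1"
      using AE_lborel_singleton[of "0::real"] AE_lborel_singleton[of "1::real"] by eventually_elim auto
    have "AE u in uniform_measure lborel {0..1}. 0 < u \<and> u < (1::real)"
      by (rule AE_uniform_measureI, simp, rule eventually_mono[OF boundary]) auto
    also have "uniform_measure lborel {0..1} = distr Q borel (\<lambda>U. U i)"
      using Q i by (simp add: copula_laws_def)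
    finally show ?thesis
      by (subst (asm) AE_distr_iff) (auto intro: measurable_vector_component[OF V i])
  qed
  then show ?thesis
    by (intro AE_finite_allI) auto
qed

text \<open>
  The half of Sklar's theorem that produces a law from a copula.  The equivalence
  \<open>q u \<le> t \<longleftrightarrow> u \<le> F t\<close> holds only for \<open>0 < u < 1\<close>, so the preimage of a box agrees with a box
  almost surely rather than everywhere.
\<close>

lemma copula_law_transform:
  assumes F: "is_cdf F" and Q: "Q \<in> copula_laws d"
  obtains P where "P \<in> vector_laws d" and "\<And>x. joint_cdf d P x = joint_cdf d Q (\<lambda>i. F (x i))"
proof -
  obtain q where q [measurable]: "q \<in> borel_measurable borel"
    and q_le: "\<And>u x. 0 < u \<Longrightarrow> u < 1 \<Longrightarrow> q u \<le> x \<longleftrightarrow> u \<le> F x"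
    using is_cdf_quantile[OF F] by blast
  have V: "Q \<in> vector_laws d"
    using Q by (simp add: copula_laws_def)
  interpret prob_space Q
    using V by (simp add: vector_laws_def)
  let ?N = "Pi\<^sub>M {1..d} (\<lambda>_. borel :: real measure)"
  let ?g = "\<lambda>U. \<lambda>i\<in>{1..d}. q (U i)"
  have g: "?g \<in> measurable Q ?N"
    by (intro measurable_restrict measurable_compose[OF _ q] measurable_vector_component[OF V])
  let ?P = "distr Q ?N ?g"
  have P: "?P \<in> vector_laws d"
    using prob_space_distr[OF g] by (simp add: vector_laws_def)
  have "joint_cdf d ?P x = joint_cdf d Q (\<lambda>i. F (x i))" for x
  proof -
    have "joint_cdf d ?P x = measure Q (?g -` {X \<in> space ?P. \<forall>i\<in>{1..d}. X i \<le> x i} \<inter> space Q)"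
      unfolding joint_cdf_def using sets_all_le[OF P] by (subst measure_distr[OF g]) auto
    also have "?g -` {X \<in> space ?P. \<forall>i\<in>{1..d}. X i \<le> x i} \<inter> space Q
                 = {U \<in> space Q. \<forall>i\<in>{1..d}. q (U i) \<le> x i}"
      using measurable_space[OF g] by (auto simp: restrict_def)
    also have "measure Q \<dots> = joint_cdf d Q (\<lambda>i. F (x i))"
      unfolding joint_cdf_def
    proof (rule finite_measure_eq_AE)
      show "{U \<in> space Q. \<forall>i\<in>{1..d}. q (U i) \<le> x i} \<in> sets Q"
        by (rule sets.sets_Collect_finite_All)
           (auto intro!: borel_measurable_le measurable_compose[OF _ q]
              measurable_vector_component[OF V])
      show "AE U in Q. U \<in> {U \<in> space Q. \<forall>i\<in>{1..d}. q (U i) \<le> x i}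
              \<longleftrightarrow> U \<in> {U \<in> space Q. \<forall>i\<in>{1..d}. U i \<le> F (x i)}"
        using AE_copula_law_interior[OF Q] by eventually_elim (auto simp: q_le)
    qed (rule sets_all_le[OF V])
    finally show ?thesis .
  qed
  with P that show thesis by blast
qed

text \<open>
  The extensionality and domain restrictions in the definition of a copula can be dropped, since a
  joint CDF depends only on the arguments with index in \<open>{1..d}\<close> and \<open>F\<close> takes values in \<open>[0, 1]\<close>.
\<close>

lemma laws_with_marginal_iff:
  assumes F: "is_cdf F"
  shows "P \<in> laws_with_marginal d F \<longleftrightarrow> P \<in> vector_laws d \<and>
     (\<exists>Q\<in>copula_laws d. \<forall>x. joint_cdf d P x = joint_cdf d Q (\<lambda>i. F (x i)))"
proof -
  have eq: "joint_cdf d P (restrict x {1..d}) = joint_cdf d P x" for P x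
    by (rule joint_cdf_cong) simp
  have cop: "restrict (joint_cdf d Q) ({1..d} \<rightarrow>\<^sub>E {0..1}) (\<lambda>i\<in>{1..d}. F (x i))
              = joint_cdf d Q (\<lambda>i. F (x i))" for Q x
    using is_cdf_bounds[OF F] by (simp add: eq PiE_iff del: One_nat_def)
  have "(\<forall>x\<in>{1..d} \<rightarrow>\<^sub>E UNIV. joint_cdf d P x = joint_cdf d Q (\<lambda>i. F (x i)))
      \<longleftrightarrow> (\<forall>x. joint_cdf d P x = joint_cdf d Q (\<lambda>i. F (x i)))" for Q
  proof (intro iffI allI)
    fix x
    assume *: "\<forall>x\<in>{1..d} \<rightarrow>\<^sub>E UNIV. joint_cdf d P x = joint_cdf d Q (\<lambda>i. F (x i))"
    have "joint_cdf d P (restrict x {1..d}) = joint_cdf d Q (\<lambda>i. F (restrict x {1..d} i))"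
      using * by (auto simp: PiE_iff)
    also have "\<dots> = joint_cdf d Q (\<lambda>i. F (x i))"
      by (rule joint_cdf_cong) simp
    finally show "joint_cdf d P x = joint_cdf d Q (\<lambda>i. F (x i))"
      by (simp only: eq)
  qed auto
  moreover have "P \<in> laws_with_marginal d F \<longleftrightarrow> P \<in> vector_laws d \<and>
      (\<exists>Q\<in>copula_laws d. \<forall>x\<in>{1..d} \<rightarrow>\<^sub>E UNIV. joint_cdf d P x
         = restrict (joint_cdf d Q) ({1..d} \<rightarrow>\<^sub>E {0..1}) (\<lambda>i\<in>{1..d}. F (x i)))"
    unfolding laws_with_marginal_def is_copula_iff by blast
  ultimately show ?thesis
    by (simp only: cop)
qed

lemma prob_max_in_image_copula:
  assumes d: "d \<ge> 1" and F: "is_cdf F" and "x \<le> y"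
  shows "prob_max_in d x y ` laws_with_marginal d F
           = prob_max_in d (F x) (F y) ` copula_laws d"
proof -
  have "F x \<le> F y"
    using is_cdf_bounds(1)[OF F] \<open>x \<le> y\<close> by (rule monoD)
  then have eq: "prob_max_in d x y P = prob_max_in d (F x) (F y) Q"
    if "P \<in> vector_laws d" "Q \<in> copula_laws d" "\<forall>x. joint_cdf d P x = joint_cdf d Q (\<lambda>i. F (x i))"
    for P Q
    using that d \<open>x \<le> y\<close> by (simp add: prob_max_in_eq_joint_cdf_diff copula_laws_def)
  show ?thesis
  proof (intro equalityI subsetI)
    fix p assume "p \<in> prob_max_in d x y ` laws_with_marginal d F"
    then show "p \<in> prob_max_in d (F x) (F y) ` copula_laws d"
      using eq by (auto simp: laws_with_marginal_iff[OF F])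
  next
    fix p assume "p \<in> prob_max_in d (F x) (F y) ` copula_laws d"
    then obtain Q where Q: "Q \<in> copula_laws d" "p = prob_max_in d (F x) (F y) Q"
      by auto
    obtain P where P: "P \<in> vector_laws d" "\<And>x. joint_cdf d P x = joint_cdf d Q (\<lambda>i. F (x i))"
      using copula_law_transform[OF F Q(1)] by blast
    then have "P \<in> laws_with_marginal d F"
      using Q(1) by (auto simp: laws_with_marginal_iff[OF F])
    then show "p \<in> prob_max_in d x y ` laws_with_marginal d F"
      using eq[OF P(1) Q(1)] P(2) Q(2) by (metis imageI)
  qed
qed

section \<open>Union bounds\<close>

lemma copula_law_component_le:
  assumes Q: "Q \<in> copula_laws d" and i: "i \<in> {1..d}" and "0 \<le> t" "t \<le> 1"
  shows "measure Q {U \<in> space Q. U i \<le> t} = t"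
proof -
  have V: "Q \<in> vector_laws d"
    using Q by (simp add: copula_laws_def)
  have "measure Q {U \<in> space Q. U i \<le> t} = measure (distr Q borel (\<lambda>U. U i)) {..t}"
    by (subst measure_distr) (auto intro: measurable_vector_component[OF V i]
          intro!: arg_cong[where f = "measure Q"])
  also have "distr Q borel (\<lambda>U. U i) = uniform_measure lborel {0..1}"
    using Q i by (simp add: copula_laws_def)
  also have "measure (uniform_measure lborel {0..1}) {..t} = measure lborel ({0..1} \<inter> {..t})"
    by simp
  also have "{0..1} \<inter> {..t} = {0..t}"
    using assms by auto
  finally show ?thesis
    using assms by simp
qed

lemma prob_max_in_copula_bounds:
  assumes d: "d \<ge> 1" and Q: "Q \<in> copula_laws d" and ab: "0 \<le> a" "a \<le> b" "b \<le> 1"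
  shows "prob_max_in d a b Q \<le> min (real d * (b - a)) b"
    and "max 0 (1 - a - real d * (1 - b)) \<le> prob_max_in d a b Q"
proof -
  have V: "Q \<in> vector_laws d"
    using Q by (simp add: copula_laws_def)
  interpret prob_space Q
    using V by (simp add: vector_laws_def)
  let ?L = "\<lambda>i t. {U \<in> space Q. U i \<le> t}"
  let ?E = "{U \<in> space Q. (\<exists>i\<in>{1..d}. a < U i) \<and> (\<forall>i\<in>{1..d}. U i \<le> b)}"
  let ?B = "\<lambda>t. {U \<in> space Q. \<forall>i\<in>{1..d}. U i \<le> t}"
  have L: "?L i t \<in> events" if "i \<in> {1..d}" for i t
    using measurable_vector_component[OF V that] by measurable
  have prob_L: "prob (?L i t) = t" if "i \<in> {1..d}" "0 \<le> t" "t \<le> 1" for i t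
    using copula_law_component_le[OF Q] that by blast
  have E: "?E = ?B b - ?B a"
    by (auto simp: not_le)
  then have E_meas: "?E \<in> events"
    using sets_all_le[OF V] by auto
  have p: "prob_max_in d a b Q = prob ?E"
    by (rule prob_max_in_eq_event[OF d])
  have one: "1 \<in> {1..d}"
    using d by simp
  have "prob ?E \<le> prob (?L 1 b)"
    using one by (intro finite_measure_mono L) auto
  then have "prob ?E \<le> b"
    using prob_L[OF one, of b] ab by simp
  moreover have "prob ?E \<le> real d * (b - a)"
  proof -
    have "prob ?E \<le> prob (\<Union>i\<in>{1..d}. ?L i b - ?L i a)"
      using L by (intro finite_measure_mono sets.finite_UN sets.Diff) (auto simp: not_le)
    also have "\<dots> \<le> (\<Sum>i\<in>{1..d}. prob (?L i b - ?L i a))"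
      using L by (intro finite_measure_subadditive_finite) auto
    also have "\<dots> = (\<Sum>i\<in>{1..d}. b - a)"
    proof (rule sum.cong)
      fix i assume i: "i \<in> {1..d}"
      have "?L i a \<subseteq> ?L i b"
        using ab by auto
      then show "prob (?L i b - ?L i a) = b - a"
        using i ab by (simp add: finite_measure_Diff L prob_L)
    qed simp
    finally show ?thesis by simp
  qed
  ultimately show "prob_max_in d a b Q \<le> min (real d * (b - a)) b"
    by (simp add: p)
  have "1 - a = prob (space Q - ?L 1 a)"
    using ab by (simp add: prob_compl[OF L[OF one]] prob_L[OF one] del: One_nat_def)
  also have "\<dots> \<le> prob (?E \<union> (\<Union>i\<in>{1..d}. space Q - ?L i b))"
    using L one by (intro finite_measure_mono sets.Un E_meas sets.finite_UN) (auto simp: not_le)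
  also have "\<dots> \<le> prob ?E + prob (\<Union>i\<in>{1..d}. space Q - ?L i b)"
    using L by (intro measure_Un_le E_meas sets.finite_UN) auto
  also have "prob (\<Union>i\<in>{1..d}. space Q - ?L i b) \<le> (\<Sum>i\<in>{1..d}. prob (space Q - ?L i b))"
    using L by (intro finite_measure_subadditive_finite) auto
  also have "\<dots> = (\<Sum>i\<in>{1..d}. 1 - b)"
    using ab by (intro sum.cong) (simp_all add: prob_compl L prob_L)
  finally have "1 - a - real d * (1 - b) \<le> prob ?E"
    by simp
  then show "max 0 (1 - a - real d * (1 - b)) \<le> prob_max_in d a b Q"
    by (simp add: p)
qed

section \<open>Rotations of an interval\<close>

text \<open>
  Rotation by \<open>c\<close> of the interval \<open>(l, r]\<close> with its ends identified, extended by the identity.  For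
  \<open>w = r - l > 0\<close> and \<open>z = v - l + c\<close>, the number \<open>\<lceil>z / w\<rceil> - 1\<close> counts the full turns to be subtracted,
  the ceiling (instead of the floor) being what keeps the result in an interval closed on the right.
\<close>

definition rotate_on :: "real \<Rightarrow> real \<Rightarrow> real \<Rightarrow> real \<Rightarrow> real" where
  "rotate_on l r c v =
     (if l < v \<and> v \<le> r then v + c - (r - l) * (of_int \<lceil>(v - l + c) / (r - l)\<rceil> - 1) else v)"

lemma rotate_on_outside: "\<not> (l < v \<and> v \<le> r) \<Longrightarrow> rotate_on l r c v = v"
  by (auto simp: rotate_on_def)

lemma rotate_on_range:
  assumes "l < v" "v \<le> r"
  shows "l < rotate_on l r c v" "rotate_on l r c v \<le> r"
proof -
  let ?z = "(v - l + c) / (r - l)"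
  have w: "r - l > 0"
    using assms by simp
  have z: "(r - l) * ?z = v - l + c"
    using w by simp
  have "(r - l) * (of_int \<lceil>?z\<rceil> - 1) < (r - l) * ?z"
    using w ceiling_correct[of ?z] by (intro mult_strict_left_mono) auto
  moreover have "(r - l) * ?z \<le> (r - l) * of_int \<lceil>?z\<rceil>"
    using w by (intro mult_left_mono) auto
  moreover have "rotate_on l r c v = v + c - (r - l) * (of_int \<lceil>?z\<rceil> - 1)"
    using assms by (simp add: rotate_on_def)
  ultimately show "l < rotate_on l r c v" "rotate_on l r c v \<le> r"
    unfolding z by (simp_all add: right_diff_distrib)
qed

lemma rotate_on_atLeastAtMost_iff:
  assumes "0 \<le> l" "r \<le> 1"
  shows "rotate_on l r c v \<in> {0..1} \<longleftrightarrow> v \<in> {0..1}"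
proof (cases "l < v \<and> v \<le> r")
  case True
  then show ?thesis
    using assms rotate_on_range[of l v r c] by auto
qed (simp add: rotate_on_outside)

text \<open>
  With \<open>\<delta>\<close> the residue of \<open>c\<close> modulo \<open>r - l\<close>, the rotation translates two complementary pieces of
  \<open>(l, r]\<close>, by \<open>\<delta>\<close> and by \<open>\<delta> - (r - l)\<close>.
\<close>

lemma rotate_on_piecewise:
  fixes l r c v :: real
  assumes "l < v" "v \<le> r"
  defines "\<delta> \<equiv> c - (r - l) * of_int \<lfloor>c / (r - l)\<rfloor>"
  shows "rotate_on l r c v = (if v + \<delta> \<le> r then v + \<delta> else v + \<delta> - (r - l))"
    and "0 \<le> \<delta>" "\<delta> < r - l"
proof -
  define w where "w = r - l"
  have w: "w > 0"
    using assms by (simp add: w_def)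
  define m where "m = \<lfloor>c / w\<rfloor>"
  have \<delta>: "\<delta> = c - w * m"
    by (simp add: \<delta>_def w_def m_def)
  have m: "m \<le> c / w" "c / w < m + 1"
    by (auto simp: m_def floor_correct)
  then show \<delta>_bounds: "0 \<le> \<delta>" "\<delta> < r - l"
    using w unfolding \<delta> w_def[symmetric] by (simp_all add: field_simps)
  have "\<lceil>(v - l + c) / w\<rceil> = (if v + \<delta> \<le> r then m + 1 else m + 2)"
    using assms(1,2) \<delta>_bounds w unfolding \<delta> w_def[symmetric]
    by (intro ceiling_unique) (auto simp: field_simps w_def)
  then show "rotate_on l r c v = (if v + \<delta> \<le> r then v + \<delta> else v + \<delta> - (r - l))"
    using assms(1,2) by (auto simp: rotate_on_def w_def[symmetric] \<delta> algebra_simps)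
qed

lemma borel_measurable_rotate_on [measurable]: "rotate_on l r c \<in> borel_measurable borel"
  unfolding rotate_on_def by measurable

lemma emeasure_lborel_translate:
  fixes t :: real
  assumes "A \<in> sets borel"
  shows "emeasure lborel ((\<lambda>v. t + v) -` A) = emeasure lborel A"
proof -
  have "emeasure lborel A = emeasure (distr lborel borel ((+) t)) A"
    by (simp add: lborel_distr_plus)
  also have "\<dots> = emeasure lborel ((+) t -` A)"
    using assms by (subst emeasure_distr) auto
  finally show ?thesis by simp
qed

lemma lborel_distr_rotate_on: "distr lborel borel (rotate_on l r c) = lborel"
proof (cases "l < r")
  case False
  then have "rotate_on l r c = (\<lambda>v. v)"
    by (auto simp: rotate_on_def fun_eq_iff)
  then show ?thesis
    by (simp add: distr_id2)
next
  case True
  define \<delta> where "\<delta> = c - (r - l) * of_int \<lfloor>c / (r - l)\<rfloor>"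
  have \<delta>: "0 \<le> \<delta>" "\<delta> < r - l"
    using rotate_on_piecewise(2,3)[of l r r c] True by (auto simp: \<delta>_def)
  show ?thesis
  proof (rule measure_eqI)
    fix A assume "A \<in> sets (distr lborel borel (rotate_on l r c))"
    then have A [measurable]: "A \<in> sets borel"
      by simp
    \<comment> \<open>The images of the two translated pieces are \<open>(l + \<delta>, r]\<close> and \<open>(l, l + \<delta>]\<close>.\<close>
    let ?A1 = "A \<inter> {l + \<delta><..r}" and ?A2 = "A \<inter> {l<..l + \<delta>}" and ?A3 = "A - {l<..r}"
    let ?B1 = "(\<lambda>v. \<delta> + v) -` ?A1" and ?B2 = "(\<lambda>v. (\<delta> - (r - l)) + v) -` ?A2"
    have meas: "?B1 \<in> sets borel" "?B2 \<in> sets borel"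
      by (auto intro!: borel_measurable_vimage simp: measurable_sets_borel)
    have "rotate_on l r c -` A = (?B1 \<union> ?B2) \<union> ?A3"
    proof (rule set_eqI)
      fix v
      show "v \<in> rotate_on l r c -` A \<longleftrightarrow> v \<in> (?B1 \<union> ?B2) \<union> ?A3"
      proof (cases "l < v \<and> v \<le> r")
        case True
        then have "rotate_on l r c v = (if v + \<delta> \<le> r then v + \<delta> else v + \<delta> - (r - l))"
          using rotate_on_piecewise(1)[of l v r c] by (simp add: \<delta>_def)
        then show ?thesis
          using True \<delta> by (auto simp: algebra_simps)
      next
        case False
        then show ?thesis
          using \<delta> by (auto simp: rotate_on_outside)
      qed
    qed
    then have "emeasure (distr lborel borel (rotate_on l r c)) A
                 = emeasure lborel ((?B1 \<union> ?B2) \<union> ?A3)"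
      by (simp add: emeasure_distr)
    also have "\<dots> = emeasure lborel ?B1 + emeasure lborel ?B2 + emeasure lborel ?A3"
    proof -
      have "?B1 \<inter> ?B2 = {}" "(?B1 \<union> ?B2) \<inter> ?A3 = {}"
        using \<delta> by auto
      then show ?thesis
        using meas by (simp add: plus_emeasure[symmetric] del: vimage_Int)
    qed
    also have "\<dots> = emeasure lborel ?A1 + emeasure lborel ?A2 + emeasure lborel ?A3"
      by (subst (1 2) emeasure_lborel_translate) auto
    also have "\<dots> = emeasure lborel ((?A1 \<union> ?A2) \<union> ?A3)"
    proof -
      have "?A1 \<inter> ?A2 = {}" "(?A1 \<union> ?A2) \<inter> ?A3 = {}"
        using \<delta> by auto
      then show ?thesis
        by (simp add: plus_emeasure[symmetric])
    qed
    also have "(?A1 \<union> ?A2) \<union> ?A3 = A"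
      using \<delta> by auto
    finally show "emeasure (distr lborel borel (rotate_on l r c)) A = emeasure lborel A" .
  qed simp
qed

lemma distr_uniform_rotate_on:
  assumes "0 \<le> l" "r \<le> 1"
  shows "distr (uniform_measure lborel {0..1}) borel (rotate_on l r c) = uniform_measure lborel {0..1}"
proof (rule measure_eqI)
  fix A :: "real set" assume "A \<in> sets (distr (uniform_measure lborel {0..1}) borel (rotate_on l r c))"
  then have A [measurable]: "A \<in> sets borel"
    by simp
  have "emeasure lborel ({0..1} \<inter> rotate_on l r c -` A)
          = emeasure lborel (rotate_on l r c -` ({0..1} \<inter> A))"
    using rotate_on_atLeastAtMost_iff[OF assms]
    by (intro arg_cong[where f = "emeasure lborel"]) blast
  also have "\<dots> = emeasure (distr lborel borel (rotate_on l r c)) ({0..1} \<inter> A)"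
    by (simp add: emeasure_distr)
  finally show "emeasure (distr (uniform_measure lborel {0..1}) borel (rotate_on l r c)) A
                  = emeasure (uniform_measure lborel {0..1}) A"
    by (simp add: emeasure_distr lborel_distr_rotate_on measurable_sets_borel[OF borel_measurable_rotate_on])
qed simp

text \<open>
  Let \<open>k j\<close> be one more than the number of turns completed after \<open>j\<close> steps of length \<open>s\<close>.  The point
  lies in the last stretch \<open>(r - s, r]\<close> after \<open>j\<close> steps if and only if \<open>k j < k (j + 1)\<close>.  As \<open>k\<close> is
  nondecreasing, this happens for some \<open>j < d\<close> if and only if \<open>k 0 < k d\<close>, and \<open>k 0 = 1\<close>.  No upper
  bound on \<open>s\<close> is needed: if \<open>s > r - l\<close>, every step completes a turn.
\<close>

lemma rotate_on_exists_gt_iff: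
  assumes v: "l < v" "v \<le> r" and s: "0 \<le> s"
  shows "(\<exists>i\<in>{1..d}. r - s < rotate_on l r (real (i - 1) * s) v) \<longleftrightarrow> r - real d * s < v"
proof -
  define w where "w = r - l"
  have w: "w > 0"
    using v by (simp add: w_def)
  define k where "k j = \<lceil>(v - l + real j * s) / w\<rceil>" for j
  have le_k: "k j \<le> n \<longleftrightarrow> v - l + real j * s \<le> w * of_int n" for j n
    using w by (simp add: k_def ceiling_le_iff field_simps)
  have k0: "k 0 = 1"
    unfolding k_def using v w by (intro ceiling_unique) (auto simp: field_simps w_def)
  have step: "r - s < rotate_on l r (real j * s) v \<longleftrightarrow> k j < k (Suc j)" for j
  proof -
    have "rotate_on l r (real j * s) v = v + real j * s - w * (of_int (k j) - 1)"
      using v by (simp add: rotate_on_def k_def w_def)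
    then have "r - s < rotate_on l r (real j * s) v \<longleftrightarrow> \<not> v - l + real (Suc j) * s \<le> w * of_int (k j)"
      by (auto simp: algebra_simps w_def)
    also have "\<dots> \<longleftrightarrow> k j < k (Suc j)"
      by (simp only: le_k[symmetric] not_le)
    finally show ?thesis .
  qed
  have mono: "k j \<le> k (Suc j)" for j
    unfolding k_def using s w by (intro ceiling_mono divide_right_mono) (auto simp: algebra_simps)
  have "(\<exists>j<d. k j < k (Suc j)) \<longleftrightarrow> k 0 < k d"
  proof
    assume "\<exists>j<d. k j < k (Suc j)"
    then obtain j where j: "j < d" "k j < k (Suc j)" by blast
    have "k 0 \<le> k j" "k (Suc j) \<le> k d"
      using lift_Suc_mono_le[of k] mono j(1) by (auto simp: Suc_le_eq)
    with j show "k 0 < k d" by simp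
  next
    assume "k 0 < k d"
    then show "\<exists>j<d. k j < k (Suc j)"
    proof (induction d)
      case (Suc d)
      then show ?case
        using mono[of d] by (cases "k 0 < k d") (auto intro: less_SucI exI[of _ d])
    qed simp
  qed
  also have "k 0 < k d \<longleftrightarrow> \<not> k d \<le> 1"
    by (auto simp: k0)
  also have "\<dots> \<longleftrightarrow> r - real d * s < v"
    by (auto simp: le_k w_def)
  finally have "(\<exists>j<d. r - s < rotate_on l r (real j * s) v) \<longleftrightarrow> r - real d * s < v"
    by (simp add: step)
  moreover have "(\<exists>i\<in>{1..d}. r - s < rotate_on l r (real (i - 1) * s) v)
      \<longleftrightarrow> (\<exists>j<d. r - s < rotate_on l r (real j * s) v)"
    unfolding image_Suc_lessThan[symmetric] by auto
  ultimately show ?thesis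
    by simp
qed

section \<open>Extremal laws\<close>

text \<open>
  The joint law of the rotations of \<open>(l, r]\<close> by \<open>0, s, \<dots>, (d - 1) s\<close>, all applied to the same uniform
  variable on \<open>[0, 1]\<close>.
\<close>

definition rotation_law :: "nat \<Rightarrow> real \<Rightarrow> real \<Rightarrow> real \<Rightarrow> (nat \<Rightarrow> real) measure" where
  "rotation_law d l r s =
     distr (uniform_measure lborel {0..1}) (Pi\<^sub>M {1..d} (\<lambda>_. borel))
       (\<lambda>v. \<lambda>i\<in>{1..d}. rotate_on l r (real (i - 1) * s) v)"

lemma prob_space_uniform_01: "prob_space (uniform_measure lborel {0..1::real})"
  by (rule prob_space_uniform_measure) auto

lemma rotation_map_measurable:
  "(\<lambda>v. \<lambda>i\<in>{1..d}. rotate_on l r (real (i - 1) * s) v)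
     \<in> measurable (uniform_measure lborel {0..1}) (Pi\<^sub>M {1..d} (\<lambda>_. borel))"
  by (intro measurable_restrict) simp

lemma rotation_law_in_copula_laws:
  assumes "0 \<le> l" "r \<le> 1"
  shows "rotation_law d l r s \<in> copula_laws d"
proof -
  have "distr (rotation_law d l r s) borel (\<lambda>U. U i) = uniform_measure lborel {0..1}"
    if i: "i \<in> {1..d}" for i
  proof -
    have "distr (rotation_law d l r s) borel (\<lambda>U. U i)
        = distr (uniform_measure lborel {0..1}) borel (rotate_on l r (real (i - 1) * s))"
      unfolding rotation_law_def
      by (subst distr_distr[OF measurable_component_singleton[OF i] rotation_map_measurable])
         (use i in \<open>simp add: o_def\<close>)
    then show ?thesis
      by (simp add: distr_uniform_rotate_on[OF assms])
  qed
  moreover have "rotation_law d l r s \<in> vector_laws d"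
    unfolding rotation_law_def vector_laws_def
    using prob_space.prob_space_distr[OF prob_space_uniform_01 rotation_map_measurable] by simp
  ultimately show ?thesis
    by (simp add: copula_laws_def)
qed

lemma prob_max_in_rotation_law:
  assumes d: "d \<ge> 1" and lr: "0 \<le> l" "r \<le> 1"
  shows "prob_max_in d a b (rotation_law d l r s) =
    measure lborel {v \<in> {0..1}. (\<exists>i\<in>{1..d}. a < rotate_on l r (real (i - 1) * s) v) \<and>
                                (\<forall>i\<in>{1..d}. rotate_on l r (real (i - 1) * s) v \<le> b)}"
proof -
  let ?N = "Pi\<^sub>M {1..d} (\<lambda>_. borel :: real measure)"
  let ?g = "\<lambda>v. \<lambda>i\<in>{1..d}. rotate_on l r (real (i - 1) * s) v"
  let ?E = "{X \<in> space ?N. (\<exists>i\<in>{1..d}. a < X i) \<and> (\<forall>i\<in>{1..d}. X i \<le> b)}"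
  let ?S = "{v. (\<exists>i\<in>{1..d}. a < rotate_on l r (real (i - 1) * s) v) \<and>
                (\<forall>i\<in>{1..d}. rotate_on l r (real (i - 1) * s) v \<le> b)}"
  have E: "?E \<in> sets ?N"
    by measurable
  have S: "?S \<in> sets borel"
    by measurable
  have "prob_max_in d a b (rotation_law d l r s) = measure (rotation_law d l r s) ?E"
    by (simp add: prob_max_in_eq_event[OF d] rotation_law_def)
  also have "\<dots> = measure (uniform_measure lborel {0..1}) (?g -` ?E \<inter> space (uniform_measure lborel {0..1}))"
    unfolding rotation_law_def by (rule measure_distr[OF rotation_map_measurable E])
  also have "?g -` ?E \<inter> space (uniform_measure lborel {0..1}) = ?S"
    by (auto simp: space_PiM)
  also have "measure (uniform_measure lborel {0..1}) ?S = measure lborel ({0..1} \<inter> ?S)"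
    using S by simp
  also have "{0..1} \<inter> ?S = {v \<in> {0..1}. v \<in> ?S}"
    by auto
  finally show ?thesis
    by simp
qed

text \<open>Here the event is that \<open>V \<in> (0, b]\<close> and its orbit meets \<open>(a, b]\<close>.\<close>

lemma prob_max_in_rotation_law_upper:
  assumes d: "d \<ge> 1" and ab: "0 \<le> a" "a \<le> b" "b \<le> 1"
  shows "prob_max_in d a b (rotation_law d 0 b (b - a)) = min (real d * (b - a)) b"
proof -
  let ?T = "\<lambda>i. rotate_on 0 b (real (i - 1) * (b - a))"
  have "{v \<in> {0..1}. (\<exists>i\<in>{1..d}. a < ?T i v) \<and> (\<forall>i\<in>{1..d}. ?T i v \<le> b)}
          = {max 0 (b - real d * (b - a))<..b}" (is "?S = ?R")
  proof (rule set_eqI)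
    fix v
    show "v \<in> ?S \<longleftrightarrow> v \<in> ?R"
    proof (cases "0 < v \<and> v \<le> b")
      case True
      then show ?thesis
        using rotate_on_range(2)[of 0 v b] rotate_on_exists_gt_iff[of 0 v b "b - a" d] ab by auto
    next
      case False
      then have "v \<notin> ?S"
        using d ab by (auto simp: rotate_on_outside dest: bspec[of _ _ 1])
      with False show ?thesis by auto
    qed
  qed
  then show ?thesis
    using ab by (simp add: prob_max_in_rotation_law[OF d] min_def max_def)
qed

text \<open>Here the event is that \<open>V \<in> (a, 1]\<close> and its orbit avoids \<open>(b, 1]\<close>.\<close>

lemma prob_max_in_rotation_law_lower:
  assumes d: "d \<ge> 1" and ab: "0 \<le> a" "a \<le> b" "b \<le> 1"
  shows "prob_max_in d a b (rotation_law d a 1 (1 - b)) = max 0 (1 - a - real d * (1 - b))"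
proof -
  let ?T = "\<lambda>i. rotate_on a 1 (real (i - 1) * (1 - b))"
  have "{v \<in> {0..1}. (\<exists>i\<in>{1..d}. a < ?T i v) \<and> (\<forall>i\<in>{1..d}. ?T i v \<le> b)}
          = {a<..1 - real d * (1 - b)}" (is "?S = ?R")
  proof (rule set_eqI)
    have d1: "1 - real d * (1 - b) \<le> 1"
      using ab by simp
    fix v
    show "v \<in> ?S \<longleftrightarrow> v \<in> ?R"
    proof (cases "a < v \<and> v \<le> 1")
      case True
      then have "(\<forall>i\<in>{1..d}. ?T i v \<le> b) \<longleftrightarrow> v \<le> 1 - real d * (1 - b)"
        using rotate_on_exists_gt_iff[of a v 1 "1 - b" d] ab by (auto simp: not_le[symmetric])
      moreover have "\<exists>i\<in>{1..d}. a < ?T i v"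
        using True rotate_on_range(1)[of a v 1] d by (intro bexI[of _ 1]) auto
      ultimately show ?thesis
        using True ab by auto
    next
      case False
      then have "v \<notin> ?S"
        by (auto simp: rotate_on_outside)
      with False d1 show ?thesis by auto
    qed
  qed
  then show ?thesis
    using ab by (simp add: prob_max_in_rotation_law[OF d] max_def)
qed

theorem theorem1:
  fixes d :: nat and F :: "real \<Rightarrow> real" and x \<epsilon> :: real
  assumes "d \<ge> 1" and "is_cdf F" and "\<epsilon> \<ge> 0"
  shows "is_maximum (prob_max_in d x (x + \<epsilon>) ` laws_with_marginal d F)
           (min (real d * (F (x + \<epsilon>) - F x)) (F (x + \<epsilon>)))
       \<and> is_minimum (prob_max_in d x (x + \<epsilon>) ` laws_with_marginal d F)
           (max 0 (1 - F x - real d * (1 - F (x + \<epsilon>))))"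
proof -
  define a b where "a = F x" and "b = F (x + \<epsilon>)"
  have ab: "0 \<le> a" "a \<le> b" "b \<le> 1"
    using is_cdf_bounds[OF assms(2)] assms(3) by (auto simp: a_def b_def intro: monoD)
  have image: "prob_max_in d x (x + \<epsilon>) ` laws_with_marginal d F
                 = prob_max_in d a b ` copula_laws d"
    using prob_max_in_image_copula[OF assms(1,2), of x "x + \<epsilon>"] assms(3) by (simp add: a_def b_def)
  have "rotation_law d 0 b (b - a) \<in> copula_laws d" "rotation_law d a 1 (1 - b) \<in> copula_laws d"
    using ab by (auto intro!: rotation_law_in_copula_laws)
  then have "min (real d * (b - a)) b \<in> prob_max_in d a b ` copula_laws d"
    and "max 0 (1 - a - real d * (1 - b)) \<in> prob_max_in d a b ` copula_laws d"
    using prob_max_in_rotation_law_upper[OF assms(1) ab]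
      prob_max_in_rotation_law_lower[OF assms(1) ab] by (metis imageI)+
  then show ?thesis
    using prob_max_in_copula_bounds[OF assms(1) _ ab]
    unfolding image a_def[symmetric] b_def[symmetric] is_maximum_def is_minimum_def by auto
qed

end
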